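(* Let $G=(V,E)$ be a simple directed graph with $V=[p]$ whose edge set contains all self-loops $i\to i$, $i\in[p]$, and let $C\in\mathrm{PD}_p$. Then $\mathcal{M}_{G,C}$ is an algebraic, and thus closed, subset of $\mathrm{PD}_p$. If $G$ is complete, then $\mathcal{M}_{G,C}=\mathrm{PD}_p$.
   Context: $[p]=\{1,\dots,p\}$, and $\mathrm{PD}_p$ is the cone of real symmetric positive definite $p\times p$ matrices. All directed graphs $G=(V,E)$ are assumed to contain all self-loops $i\to i$. $G$ is simple if there are no two distinct nodes $i,j$ with both $i\to j\in E$ and $j\to i\in E$. A simple directed graph is complete if there is an edge between every pair of distinct nodes. $\mathbb{R}^E$ is the space of real $p\times p$ matrices $M=(m_{ij})$ with $m_{ji}=0$ whenever $i\to j\notin E$. For $C\in\mathrm{PD}_p$, $\mathcal{M}_{G,C}=\{\Sigma\in\mathrm{PD}_p: M\Sigma+\Sigma M^\top=-C \text{ for some } M\in\mathbb{R}^E\}$. An algebraic subset of $\mathrm{PD}_p$ is the set of matrices in $\mathrm{PD}_p$ at which a given set of polynomials in the matrix entries vanishes; closed means closed relative to $\mathrm{PD}_p$. *)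

theory Defs
  imports "HOL-Analysis.Analysis"
begin

text \<open>
  The vertex set is an arbitrary finite index type \<open>'n\<close> with \<open>p = CARD('n)\<close>, and a directed graph on
  it is its edge set: \<open>(i, j) \<in> E\<close> means \<open>i \<rightarrow> j\<close>.
\<close>

definition has_self_loops :: "('n \<times> 'n) set \<Rightarrow> bool" where
  "has_self_loops E \<longleftrightarrow> (\<forall>i. (i, i) \<in> E)"

definition simple_digraph :: "('n \<times> 'n) set \<Rightarrow> bool" where
  "simple_digraph E \<longleftrightarrow> \<not> (\<exists>i j. i \<noteq> j \<and> (i, j) \<in> E \<and> (j, i) \<in> E)"

definition complete_digraph :: "('n \<times> 'n) set \<Rightarrow> bool" where
  "complete_digraph E \<longleftrightarrow>
     simple_digraph E \<and> (\<forall>i j. i \<noteq> j \<longrightarrow> (i, j) \<in> E \<or> (j, i) \<in> E)"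

definition PD :: "(real ^ 'n::finite ^ 'n) set" where
  "PD = {A. transpose A = A \<and> (\<forall>x. x \<noteq> 0 \<longrightarrow> 0 < x \<bullet> (A *v x))}"

text \<open>The space \<open>\<real>\<^sup>E\<close>. Note the transposition: the edge \<open>i \<rightarrow> j\<close> corresponds to the entry \<open>(j, i)\<close>.\<close>

definition edge_matrices :: "('n \<times> 'n) set \<Rightarrow> (real ^ 'n::finite ^ 'n) set" where
  "edge_matrices E = {M. \<forall>i j. (i, j) \<notin> E \<longrightarrow> M $ j $ i = 0}"

definition lyapunov_model ::
  "('n \<times> 'n) set \<Rightarrow> real ^ 'n ^ 'n \<Rightarrow> (real ^ 'n::finite ^ 'n) set" where
  "lyapunov_model E C =
     {\<Sigma> \<in> PD. \<exists>M \<in> edge_matrices E. M ** \<Sigma> + \<Sigma> ** transpose M = - C}"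

text \<open>
  On \<open>real ^ 'n ^ 'n\<close>, \<^const>\<open>real_polynomial_function\<close> describes exactly the polynomials in the matrix
  entries, since the bounded linear functionals are the linear combinations of the entries.
\<close>

definition algebraic_subset_of_PD :: "(real ^ 'n::finite ^ 'n) set \<Rightarrow> bool" where
  "algebraic_subset_of_PD S \<longleftrightarrow>
     (\<exists>F. (\<forall>f \<in> F. real_polynomial_function f) \<and> S = {\<Sigma> \<in> PD. \<forall>f \<in> F. f \<Sigma> = 0})"

end

theory Submission imports Defs begin

text \<open>
  For \<open>\<Sigma>\<close> positive definite, the Lyapunov map \<open>M \<mapsto> M \<Sigma> + \<Sigma> M\<^sup>T\<close> is injective on \<open>\<real>\<^sup>E\<close> when the
  graph is simple: on its kernel \<open>M\<close> equals \<open>- \<Sigma> M\<^sup>T \<Sigma>\<^sup>-\<^sup>1\<close>, so \<open>tr (M\<^sup>2) = - tr (M \<Sigma> M\<^sup>T \<Sigma>\<^sup>-\<^sup>1) \<le> 0\<close> with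
  equality only for \<open>M = 0\<close>, while simplicity gives \<open>tr (M\<^sup>2) = \<Sum>\<^sub>i m\<^sub>i\<^sub>i\<^sup>2 \<ge> 0\<close>. For a complete graph
  the symmetric matrix \<open>M \<Sigma> + \<Sigma> M\<^sup>T\<close> is determined by its entries on \<open>E\<close>, so injectivity turns into
  surjectivity. In general, injectivity keeps a Gram determinant away from zero on the whole cone,
  and solvability of the Lyapunov equation becomes a polynomial condition on \<open>\<Sigma>\<close>.
\<close>

section \<open>Positive semidefinite matrices and their factorization\<close>

definition psd :: "(real ^ 'n::finite ^ 'n) set" where
  "psd = {A. transpose A = A \<and> (\<forall>x. 0 \<le> x \<bullet> (A *v x))}"

lemma psdD:
  assumes "A \<in> psd"
  shows "A $ i $ j = A $ j $ i" and "0 \<le> x \<bullet> (A *v x)"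
proof -
  show "A $ i $ j = A $ j $ i"
    using assms unfolding psd_def transpose_def by (auto simp: vec_eq_iff)
qed (use assms in \<open>auto simp: psd_def\<close>)

text \<open>Moving along one coordinate makes the form a quadratic polynomial in \<open>t\<close>;
  suitable values of \<open>t\<close> give the next two lemmas.\<close>

lemma quadratic_form_add_axis:
  fixes A :: "real ^ 'n::finite ^ 'n"
  assumes "transpose A = A"
  shows "(x + t *\<^sub>R axis i 1) \<bullet> (A *v (x + t *\<^sub>R axis i 1)) =
    x \<bullet> (A *v x) + 2 * t * (A *v x) $ i + t\<^sup>2 * A $ i $ i"
proof -
  have "x \<bullet> (A *v axis i 1) = (A *v x) $ i"
    by (metis assms inner_axis inner_real_def mult.right_neutral
        dot_lmul_matrix vector_transpose_matrix inner_commute)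
  moreover have "axis i 1 \<bullet> (A *v axis i 1) = A $ i $ i"
    by (simp add: inner_axis' matrix_vector_mul_component inner_axis)
  ultimately show ?thesis
    by (simp add: matrix_vector_right_distrib matrix_vector_mult_scaleR inner_add_left inner_add_right
        inner_axis' power2_eq_square algebra_simps)
qed

text \<open>At \<open>axis j 1 + t *\<^sub>R axis i 1\<close> the form is affine in \<open>t\<close>
  with slope \<open>2 * A $ i $ j\<close>, so it stays nonnegative only if the slope is
  zero.\<close>

lemma psd_diag_zero_row_zero:
  assumes A: "A \<in> psd" and "A $ i $ i = 0"
  shows "A $ i $ j = 0"
proof (rule ccontr)
  assume nz: "A $ i $ j \<noteq> 0"
  \<comment> \<open>The solution of \<open>A $ j $ j + 2 * t * A $ i $ j = -1\<close>.\<close>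
  define t where "t = - (A $ j $ j + 1) / (2 * A $ i $ j)"
  have "axis j 1 \<bullet> (A *v axis j 1) = A $ j $ j" "(A *v axis j 1) $ i = A $ i $ j"
    by (simp_all add: inner_axis' matrix_vector_mul_component inner_axis)
  then have "0 \<le> A $ j $ j + 2 * t * A $ i $ j"
    using psdD(2)[OF A, of "axis j 1 + t *\<^sub>R axis i 1"] assms
      quadratic_form_add_axis[of A "axis j 1" t i] by (simp add: psd_def)
  also have "\<dots> = -1"
    using nz by (simp add: t_def field_simps)
  finally show False by simp
qed

text \<open>The form of the Schur complement at \<open>x\<close> is the minimum over
  \<open>t\<close> of the form of \<open>A\<close> at \<open>x + t *\<^sub>R axis i 1\<close>,
  attained at \<open>t = - (A *v x) $ i / A $ i $ i\<close>.\<close>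

lemma psd_schur_complement:
  assumes A: "A \<in> psd" and pos: "0 < A $ i $ i"
  shows "(\<chi> k l. A $ k $ l - A $ k $ i * A $ i $ l / A $ i $ i) \<in> psd" (is "?B \<in> psd")
proof -
  have "0 \<le> x \<bullet> (?B *v x)" for x
  proof -
    define s where "s = (A *v x) $ i"
    have s: "s = (\<Sum>l\<in>UNIV. A $ i $ l * x $ l)"
      by (simp add: s_def matrix_vector_mult_def)
    have "?B *v x = A *v x - (s / A $ i $ i) *\<^sub>R (\<chi> k. A $ k $ i)"
      by (simp add: vec_eq_iff matrix_vector_mult_def s left_diff_distrib right_diff_distrib sum_subtractf
          sum_distrib_left sum_distrib_right sum_divide_distrib mult_ac)
    moreover have "x \<bullet> (\<chi> k. A $ k $ i) = s"
      by (simp add: inner_vec_def s psdD(1)[OF A, of _ i] mult.commute)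
    ultimately have "x \<bullet> (?B *v x) = x \<bullet> (A *v x) - s\<^sup>2 / A $ i $ i"
      by (simp add: inner_diff_right power2_eq_square)
    also have "\<dots> = (x + (- s / A $ i $ i) *\<^sub>R axis i 1) \<bullet> (A *v (x + (- s / A $ i $ i) *\<^sub>R axis i 1))"
      using pos A by (subst quadratic_form_add_axis)
        (auto simp: psd_def s_def[symmetric] power2_eq_square field_simps)
    finally show ?thesis
      using psdD(2)[OF A] by simp
  qed
  moreover have "transpose ?B = ?B"
    using psdD(1)[OF A] by (simp add: transpose_def vec_eq_iff mult.commute)
  ultimately show ?thesis
    by (simp add: psd_def)
qed

text \<open>Cholesky elimination, one pivot per induction step: subtracting a rank-one matrix clears
  row \<open>i\<close>. The support condition on \<open>V\<close> keeps column \<open>i\<close> free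
  for that pivot.\<close>

lemma psd_factorization_supported:
  fixes A :: "real ^ 'n::finite ^ 'n"
  assumes "finite I" "A \<in> psd" "\<And>i j. i \<notin> I \<Longrightarrow> A $ i $ j = 0"
  shows "\<exists>V. A = V ** transpose V \<and> (\<forall>i k. k \<notin> I \<longrightarrow> V $ i $ k = 0)"
  using assms
proof (induction I arbitrary: A rule: finite_induct)
  case empty
  then have "A = 0 ** transpose 0"
    by (simp add: vec_eq_iff)
  then show ?case
    by (intro exI[of _ 0]) simp
next
  case (insert i I)
  show ?case
  proof (cases "A $ i $ i = 0")
    \<comment> \<open>A zero pivot forces a zero row, so the induction hypothesis applies to
      \<open>A\<close> itself.\<close>
    case True
    then have "\<And>k j. k \<notin> I \<Longrightarrow> A $ k $ j = 0"
      using psd_diag_zero_row_zero insert.prems by (metis insert_iff)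
    then show ?thesis
      using insert.IH insert.prems(1) by (meson insertI2)
  next
    case False
    have "A $ i $ i = axis i 1 \<bullet> (A *v axis i 1)"
      by (simp add: inner_axis' matrix_vector_mul_component inner_axis)
    then have pos: "0 < A $ i $ i"
      using psdD(2)[OF insert.prems(1), of "axis i 1"] False by linarith
    let ?B = "\<chi> k l. A $ k $ l - A $ k $ i * A $ i $ l / A $ i $ i"
    have "?B $ k $ j = 0" if "k \<notin> I" for k j
      using that insert.prems(2)[of k] False by (cases "k = i") auto
    then obtain W where W: "?B = W ** transpose W" "\<And>j k. k \<notin> I \<Longrightarrow> W $ j $ k = 0"
      using insert.IH[OF psd_schur_complement[OF insert.prems(1) pos]] by blast
    \<comment> \<open>Column \<open>i\<close> of \<open>W\<close> is zero because
      \<open>i \<notin> I\<close>; the scaled pivot column put there contributes exactly the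
      rank-one matrix that was subtracted.\<close>
    define V :: "real ^ 'n ^ 'n" where
      "V = (\<chi> j k. if k = i then A $ j $ i / sqrt (A $ i $ i) else W $ j $ k)"
    have "A $ k $ l = (V ** transpose V) $ k $ l" for k l
    proof -
      have "(\<Sum>m\<in>UNIV - {i}. V $ k $ m * V $ l $ m) = (\<Sum>m\<in>UNIV - {i}. W $ k $ m * W $ l $ m)"
        by (intro sum.cong) (auto simp: V_def)
      also have "\<dots> = (\<Sum>m\<in>UNIV. W $ k $ m * W $ l $ m)"
        using W(2)[OF insert.hyps(2)] by (subst (2) sum.remove[of _ i]) auto
      also have "\<dots> = ?B $ k $ l"
        by (subst W(1)) (simp add: matrix_matrix_mult_def transpose_def)
      finally have "(\<Sum>m\<in>UNIV. V $ k $ m * V $ l $ m) = V $ k $ i * V $ l $ i + ?B $ k $ l"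
        by (subst sum.remove[of _ i]) auto
      moreover have "V $ k $ i * V $ l $ i = A $ k $ i * A $ i $ l / A $ i $ i"
        using pos by (simp add: V_def psdD(1)[OF insert.prems(1), of i l])
      ultimately show ?thesis
        by (simp add: matrix_matrix_mult_def transpose_def)
    qed
    then have "A = V ** transpose V"
      by (simp add: vec_eq_iff)
    moreover have "\<forall>j k. k \<notin> insert i I \<longrightarrow> V $ j $ k = 0"
      by (simp add: V_def W(2))
    ultimately show ?thesis by blast
  qed
qed

lemma psd_factorization:
  fixes A :: "real ^ 'n::finite ^ 'n"
  assumes "A \<in> psd"
  obtains V :: "real ^ 'n ^ 'n" where "A = V ** transpose V"
proof -
  have "\<exists>V :: real ^ 'n ^ 'n. A = V ** transpose V \<and> (\<forall>i k. k \<notin> UNIV \<longrightarrow> V $ i $ k = 0)"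
    using assms by (intro psd_factorization_supported) auto
  then show ?thesis using that by blast
qed

section \<open>Positive definite matrices: inverses and traces of congruences\<close>

lemma PD_subset_psd: "PD \<subseteq> psd"
proof
  fix A :: "real ^ 'n ^ 'n"
  assume "A \<in> PD"
  then show "A \<in> psd"
    unfolding PD_def psd_def by (auto intro: order.strict_implies_order) (metis inner_zero_left order.order_iff_strict)
qed

lemma PD_invertible:
  assumes "A \<in> PD"
  shows "invertible A"
proof -
  have "x = 0" if "A *v x = 0" for x
    using assms that by (force simp: PD_def)
  then show ?thesis
    by (simp add: invertible_left_inverse matrix_left_invertible_ker)
qed

text \<open>With \<open>y = P *v x\<close>, the form of \<open>P\<close> at \<open>x\<close> is the
  form of \<open>A\<close> at \<open>y\<close>.\<close>

lemma psd_inverse: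
  assumes A: "A \<in> PD" and AP: "A ** P = mat 1" "P ** A = mat 1"
  shows "P \<in> psd"
proof -
  have tA: "transpose A = A"
    using A by (simp add: PD_def)
  have "transpose P = transpose P ** (A ** P)"
    by (simp add: AP)
  also have "\<dots> = transpose (A ** P) ** P"
    by (simp add: matrix_transpose_mul tA matrix_mul_assoc)
  finally have tP: "transpose P = P"
    by (simp add: AP)
  have "0 \<le> x \<bullet> (P *v x)" for x
  proof -
    have "x = A *v (P *v x)"
      by (simp add: matrix_vector_mul_assoc AP)
    then have "x \<bullet> (P *v x) = (P *v x) \<bullet> (A *v (P *v x))"
      by (simp add: inner_commute)
    also have "0 \<le> \<dots>"
      using A PD_subset_psd psdD(2) by blast
    finally show ?thesis .
  qed
  with tP show ?thesis by (simp add: psd_def)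
qed

lemma diag_congruence:
  fixes A W :: "real ^ 'n::finite ^ 'n"
  shows "(transpose W ** A ** W) $ k $ k = column k W \<bullet> (A *v column k W)"
proof -
  have "(transpose W ** (A ** W)) $ k $ k = column k W \<bullet> (A *v column k W)"
    by (simp add: matrix_matrix_mult_def transpose_def inner_vec_def column_def matrix_vector_mult_def)
  then show ?thesis by (simp add: matrix_mul_assoc)
qed

lemma trace_congruence_nonneg:
  fixes A W :: "real ^ 'n::finite ^ 'n"
  assumes "A \<in> PD"
  shows "0 \<le> trace (transpose W ** A ** W)"
  unfolding trace_def diag_congruence
  using assms PD_subset_psd psdD(2) by (blast intro: sum_nonneg)

text \<open>The trace sums the form of \<open>A\<close> over the columns of \<open>W\<close>. All
  terms are nonnegative, so each is zero, and definiteness kills every column.\<close>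

lemma trace_congruence_eq_0:
  fixes A W :: "real ^ 'n::finite ^ 'n"
  assumes A: "A \<in> PD" and "trace (transpose W ** A ** W) = 0"
  shows "W = 0"
proof -
  have nn: "0 \<le> column k W \<bullet> (A *v column k W)" for k
    using A PD_subset_psd psdD(2) by blast
  have "(\<Sum>k\<in>UNIV. column k W \<bullet> (A *v column k W)) = 0"
    using assms(2) by (simp add: trace_def diag_congruence)
  then have "\<forall>k\<in>UNIV. column k W \<bullet> (A *v column k W) = 0"
    using nn by (simp add: sum_nonneg_eq_0_iff)
  then have "column k W = 0" for k
    using A unfolding PD_def by force
  then show ?thesis
    by (simp add: vec_eq_iff column_def)
qed

lemma trace_square_simple:
  assumes "simple_digraph E" "M \<in> edge_matrices E"
  shows "0 \<le> trace (M ** M)"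
proof -
  \<comment> \<open>Of two opposite off-diagonal entries, at least one lies off the edge
    set.\<close>
  have "M $ i $ j * M $ j $ i = 0" if "i \<noteq> j" for i j
    using assms that unfolding simple_digraph_def edge_matrices_def by fastforce
  then have "0 \<le> M $ i $ j * M $ j $ i" for i j
    by (cases "i = j") (simp, metis order_refl)
  then show ?thesis
    by (simp add: trace_def matrix_matrix_mult_def sum_nonneg)
qed

section \<open>The Lyapunov map and its injectivity\<close>

definition lyapunov_map :: "real ^ 'n ^ 'n \<Rightarrow> real ^ 'n ^ 'n \<Rightarrow> real ^ 'n::finite ^ 'n" where
  "lyapunov_map \<Sigma> M = M ** \<Sigma> + \<Sigma> ** transpose M"

lemma lyapunov_map_nth:
  "lyapunov_map \<Sigma> M $ i $ j = (\<Sum>k\<in>UNIV. M $ i $ k * \<Sigma> $ k $ j) + (\<Sum>k\<in>UNIV. \<Sigma> $ i $ k * M $ j $ k)"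
  by (simp add: lyapunov_map_def matrix_matrix_mult_def transpose_def)

lemma linear_lyapunov_map: "linear (lyapunov_map \<Sigma>)"
  by (rule linearI) (simp_all add: vec_eq_iff lyapunov_map_nth distrib_left distrib_right sum.distrib sum_distrib_left mult_ac)

text \<open>Linearity in \<Sigma> is what later makes the Gram determinants polynomial in
  \<Sigma>.\<close>

lemma linear_lyapunov_map_left: "linear (\<lambda>\<Sigma>. lyapunov_map \<Sigma> M)"
  by (rule linearI) (simp_all add: vec_eq_iff lyapunov_map_nth distrib_left distrib_right sum.distrib sum_distrib_left mult_ac)

lemma lyapunov_map_symmetric:
  assumes "\<Sigma> \<in> PD"
  shows "lyapunov_map \<Sigma> M $ i $ j = lyapunov_map \<Sigma> M $ j $ i"
proof -
  have "\<Sigma> $ i $ j = \<Sigma> $ j $ i" for i j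
    using assms PD_subset_psd psdD(1) by blast
  then show ?thesis
    by (simp add: lyapunov_map_nth mult.commute add.commute)
qed

lemma lyapunov_map_injective:
  fixes M \<Sigma> :: "real ^ 'n::finite ^ 'n"
  assumes E: "simple_digraph E" and M: "M \<in> edge_matrices E" and S: "\<Sigma> \<in> PD"
    and zero: "lyapunov_map \<Sigma> M = 0"
  shows "M = 0"
proof -
  obtain P where P: "\<Sigma> ** P = mat 1" "P ** \<Sigma> = mat 1"
    using PD_invertible[OF S] unfolding invertible_def by blast
  obtain V :: "real ^ 'n ^ 'n" where V: "P = V ** transpose V"
    using psd_factorization[OF psd_inverse[OF S P]] by blast
  \<comment> \<open>Chosen so that, by cyclicity of the trace,
    \<open>trace (transpose W ** \<Sigma> ** W)\<close> equals the trace of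
    \<open>M ** \<Sigma> ** transpose M ** P\<close>.\<close>
  define W where "W = transpose M ** V"
  have neg: "\<Sigma> ** transpose M = - (M ** \<Sigma>)"
    using zero by (simp add: lyapunov_map_def eq_neg_iff_add_eq_0 add.commute)
  have minus_left: "(- A) ** B = - (A ** B)" and minus_right: "A ** (- B) = - (A ** B)"
    for A B :: "real ^ 'n ^ 'n"
    by (simp_all add: vec_eq_iff matrix_matrix_mult_def sum_negf)
  have "transpose W ** \<Sigma> ** W = transpose V ** (M ** (\<Sigma> ** transpose M) ** V)"
    by (simp add: W_def matrix_transpose_mul matrix_mul_assoc)
  then have "trace (transpose W ** \<Sigma> ** W) = trace ((M ** (\<Sigma> ** transpose M) ** V) ** transpose V)"
    by (simp only: trace_mul_sym[of "transpose V"])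
  also have "\<dots> = trace (M ** (\<Sigma> ** transpose M) ** P)"
    by (simp only: V matrix_mul_assoc)
  \<comment> \<open>The kernel relation moves \<Sigma> next to its inverse \<open>P\<close>.\<close>
  also have "M ** (\<Sigma> ** transpose M) ** P = - (M ** M ** (\<Sigma> ** P))"
    unfolding neg minus_left minus_right by (simp only: matrix_mul_assoc)
  also have "trace \<dots> = - trace (M ** M)"
    by (simp add: P trace_def sum_negf)
  \<comment> \<open>A nonnegative trace equals the negative of another nonnegative trace, so both
    vanish.\<close>
  finally have "trace (transpose W ** \<Sigma> ** W) = 0"
    using trace_square_simple[OF E M] trace_congruence_nonneg[OF S, of W] by linarith
  then have "W = 0"
    by (rule trace_congruence_eq_0[OF S])
  \<comment> \<open>Recovers \<open>M\<close> from \<open>W\<close>, as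
    \<open>V ** transpose V ** \<Sigma> = P ** \<Sigma>\<close> is the identity.\<close>
  moreover have "transpose M = W ** transpose V ** \<Sigma>"
    unfolding W_def by (metis V P(2) matrix_mul_assoc matrix_mul_rid)
  ultimately have "transpose M = 0"
    by simp
  then show "M = 0"
    by (simp add: transpose_def vec_eq_iff)
qed

section \<open>Complete graphs\<close>

lemma lyapunov_model_complete:
  assumes E: "complete_digraph E" "has_self_loops E" and C: "C \<in> PD"
  shows "lyapunov_model E C = PD"
proof -
  have "\<exists>M \<in> edge_matrices E. lyapunov_map \<Sigma> M = - C" if S: "\<Sigma> \<in> PD" for \<Sigma>
  proof -
    \<comment> \<open>The self-loops supply the case \<open>i = j\<close>.\<close>
    have simp: "simple_digraph E" and edge: "(i, j) \<in> E \<or> (j, i) \<in> E" for i j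
      using E unfolding complete_digraph_def has_self_loops_def by metis+
    \<comment> \<open>An endomorphism of the full matrix space, so that injectivity yields
      surjectivity: edge positions hold the Lyapunov image, the others hold \<open>M\<close>
      itself.\<close>
    define U where "U M = (\<chi> j i. if (i, j) \<in> E then lyapunov_map \<Sigma> M $ j $ i else M $ j $ i)" for M
    \<comment> \<open>Every pair of indices carries an edge in some direction; symmetry transfers
      the equality to the opposite entry.\<close>
    have eqI: "lyapunov_map \<Sigma> M = D"
      if "\<And>i j. (i, j) \<in> E \<Longrightarrow> lyapunov_map \<Sigma> M $ j $ i = D $ j $ i" "transpose D = D" for M D
    proof -
      have "D $ i $ j = D $ j $ i" for i j
        using that(2) by (simp add: transpose_def vec_eq_iff)
      then show ?thesis
        unfolding vec_eq_iff using that(1) edge lyapunov_map_symmetric[OF S] by metis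
    qed
    have "linear U"
      by (rule linearI) (simp_all add: vec_eq_iff U_def linear_add[OF linear_lyapunov_map]
          linear_scale[OF linear_lyapunov_map])
    moreover have "M = 0" if "U M = 0" for M
    proof (rule lyapunov_map_injective[OF simp _ S])
      have U0: "(if (i, j) \<in> E then lyapunov_map \<Sigma> M $ j $ i else M $ j $ i) = 0" for i j
        using that by (simp add: U_def vec_eq_iff)
      show "M \<in> edge_matrices E"
        unfolding edge_matrices_def mem_Collect_eq using U0 by (metis (full_types))
      show "lyapunov_map \<Sigma> M = 0"
      proof (rule eqI)
        show "lyapunov_map \<Sigma> M $ j $ i = 0 $ j $ i" if "(i, j) \<in> E" for i j
          using U0[of i j] that by simp
      qed (simp add: transpose_def vec_eq_iff)
    qed
    ultimately have "surj U"
      by (simp add: linear_injective_0 linear_injective_imp_surjective)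
    \<comment> \<open>Zeros off the edges force the preimage into \<open>edge_matrices E\<close>,
      while the edge positions prescribe the right-hand side \<open>- C\<close>.\<close>
    then obtain M where UM: "(\<chi> j i. if (i, j) \<in> E then - C $ j $ i else 0) = U M"
      by (rule surjE)
    have M: "(if (i, j) \<in> E then lyapunov_map \<Sigma> M $ j $ i else M $ j $ i)
        = (if (i, j) \<in> E then - C $ j $ i else 0)" for i j
      using arg_cong[OF UM, of "\<lambda>A. A $ j $ i"] by (simp add: U_def)
    have "lyapunov_map \<Sigma> M = - C"
    proof (rule eqI)
      show "lyapunov_map \<Sigma> M $ j $ i = (- C) $ j $ i" if "(i, j) \<in> E" for i j
        using M[of i j] that by simp
      show "transpose (- C) = - C"
        using C by (simp add: PD_def transpose_def vec_eq_iff)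
    qed
    moreover have "M \<in> edge_matrices E"
      unfolding edge_matrices_def mem_Collect_eq using M by (metis (full_types))
    ultimately show ?thesis by blast
  qed
  then show ?thesis
    by (auto simp: lyapunov_model_def lyapunov_map_def)
qed

section \<open>Gram matrices and Cramer's rule\<close>

text \<open>
  Cramer's rule for the normal equations: the candidate coefficients of \<open>c\<close> are ratios of
  determinants, so clearing the denominator \<open>det G\<close> leaves a polynomial condition.
\<close>

definition gram :: "('k \<Rightarrow> 'b::euclidean_space) \<Rightarrow> real ^ 'k::finite ^ 'k" where
  "gram w = (\<chi> k l. w k \<bullet> w l)"

text \<open>The numerator matrix in Cramer's rule: column \<open>m\<close> holds the right-hand side
  of the normal equations.\<close>

definition gram_replace :: "('k \<Rightarrow> 'b::euclidean_space) \<Rightarrow> 'b \<Rightarrow> 'k \<Rightarrow> real ^ 'k::finite ^ 'k" where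
  "gram_replace w c m = (\<chi> k l. if l = m then w k \<bullet> c else w k \<bullet> w l)"

lemma gram_mult_vec: "gram w *v x = (\<chi> k. w k \<bullet> (\<Sum>l\<in>UNIV. x $ l *\<^sub>R w l))"
  by (simp add: gram_def vec_eq_iff matrix_vector_mult_def inner_sum_right mult.commute)

text \<open>A kernel vector of the Gram matrix yields a combination orthogonal to every
  \<open>w k\<close>, hence to itself.\<close>

lemma det_gram_nonzero:
  assumes indep: "\<And>x. (\<Sum>k\<in>UNIV. x $ k *\<^sub>R w k) = 0 \<Longrightarrow> x = 0"
  shows "det (gram w) \<noteq> 0"
proof -
  have "x = 0" if "gram w *v x = 0" for x
  proof (rule indep)
    let ?s = "\<Sum>k\<in>UNIV. x $ k *\<^sub>R w k"
    have "w k \<bullet> ?s = 0" for k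
      using that by (simp add: gram_mult_vec vec_eq_iff)
    then have "?s \<bullet> ?s = 0"
      by (subst inner_sum_left) simp
    then show "?s = 0" by simp
  qed
  then have "invertible (gram w)"
    by (simp add: invertible_left_inverse matrix_left_invertible_ker)
  then show ?thesis
    by (simp add: invertible_det_nz)
qed

text \<open>The normal equations always have a solution; it gives the orthogonal projection of
  \<open>c\<close> onto the span of \<open>w\<close>. The condition on the right says that this
  projection is \<open>c\<close>.\<close>

lemma combination_iff_gram:
  fixes w :: "'k::finite \<Rightarrow> 'b::euclidean_space"
  assumes indep: "\<And>x. (\<Sum>k\<in>UNIV. x $ k *\<^sub>R w k) = 0 \<Longrightarrow> x = 0"
  shows "(\<exists>x. (\<Sum>k\<in>UNIV. x $ k *\<^sub>R w k) = c) \<longleftrightarrow>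
    (\<Sum>k\<in>UNIV. det (gram_replace w c k) *\<^sub>R w k) = det (gram w) *\<^sub>R c"
proof -
  have nz: "det (gram w) \<noteq> 0"
    using indep by (rule det_gram_nonzero)
  have replace: "(\<chi> i j. if j = m then (\<chi> k. w k \<bullet> c) $ i else gram w $ i $ j) = gram_replace w c m" for m
    by (simp add: vec_eq_iff gram_def gram_replace_def)
  show ?thesis
  proof
    assume "\<exists>x. (\<Sum>k\<in>UNIV. x $ k *\<^sub>R w k) = c"
    then obtain x where x: "(\<Sum>k\<in>UNIV. x $ k *\<^sub>R w k) = c" by blast
    then have "gram w *v x = (\<chi> k. w k \<bullet> c)"
      by (simp add: gram_mult_vec)
    then have "x = (\<chi> k. det (gram_replace w c k) / det (gram w))"
      by (simp only: cramer[OF nz] replace)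
    then have "det (gram_replace w c k) = det (gram w) * x $ k" for k
      using nz by simp
    then show "(\<Sum>k\<in>UNIV. det (gram_replace w c k) *\<^sub>R w k) = det (gram w) *\<^sub>R c"
      unfolding x[symmetric] scaleR_sum_right by simp
  next
    assume eq: "(\<Sum>k\<in>UNIV. det (gram_replace w c k) *\<^sub>R w k) = det (gram w) *\<^sub>R c"
    let ?x = "\<chi> k. det (gram_replace w c k) / det (gram w)"
    have "(\<Sum>k\<in>UNIV. ?x $ k *\<^sub>R w k) =
        inverse (det (gram w)) *\<^sub>R (\<Sum>k\<in>UNIV. det (gram_replace w c k) *\<^sub>R w k)"
      by (simp add: scaleR_sum_right divide_inverse mult.commute)
    then show "\<exists>x. (\<Sum>k\<in>UNIV. x $ k *\<^sub>R w k) = c"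
      using nz by (intro exI[of _ ?x]) (simp add: eq)
  qed
qed

section \<open>Polynomial conditions for solvability\<close>

lemma real_polynomial_function_inner:
  fixes f g :: "'a::real_normed_vector \<Rightarrow> 'b::euclidean_space"
  assumes "polynomial_function f" "polynomial_function g"
  shows "real_polynomial_function (\<lambda>x. f x \<bullet> g x)"
proof -
  have "real_polynomial_function (\<lambda>x. f x \<bullet> b)" "real_polynomial_function (\<lambda>x. g x \<bullet> b)" for b
    using assms bounded_linear_inner_left[of b] by (auto simp: polynomial_function_def o_def)
  then show ?thesis
    by (subst euclidean_inner)
      (intro real_polynomial_function_sum finite_Basis real_polynomial_function.intros(4))
qed

lemma real_polynomial_function_det:
  fixes A :: "'a::real_normed_vector \<Rightarrow> real ^ 'k::finite ^ 'k"
  assumes "\<And>i j. real_polynomial_function (\<lambda>x. A x $ i $ j)"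
  shows "real_polynomial_function (\<lambda>x. det (A x))"
  unfolding det_def
  by (intro real_polynomial_function_sum real_polynomial_function.intros(4) real_polynomial_function.intros(2)
      real_polynomial_function_prod assms) (auto intro: finite_permutations)

lemma combination_polynomial_conditions:
  fixes w :: "'a::real_normed_vector \<Rightarrow> 'k::finite \<Rightarrow> 'b::euclidean_space"
  assumes poly: "\<And>k. polynomial_function (\<lambda>p. w p k)"
    and indep: "\<And>p x. p \<in> S \<Longrightarrow> (\<Sum>k\<in>UNIV. x $ k *\<^sub>R w p k) = 0 \<Longrightarrow> x = 0"
  shows "\<exists>F. (\<forall>f\<in>F. real_polynomial_function f) \<and>
    {p \<in> S. \<exists>x. (\<Sum>k\<in>UNIV. x $ k *\<^sub>R w p k) = c} = {p \<in> S. \<forall>f\<in>F. f p = 0}"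
proof (intro exI conjI)
  \<comment> \<open>The residual in \<open>combination_iff_gram\<close>. It is polynomial in
    \<open>p\<close>, and its coordinates give finitely many real polynomials that work for all of
    \<open>S\<close>.\<close>
  define r where
    "r p = (\<Sum>k\<in>UNIV. det (gram_replace (w p) c k) *\<^sub>R w p k) - det (gram (w p)) *\<^sub>R c" for p
  let ?F = "(\<lambda>b p. r p \<bullet> b) ` Basis"
  have "real_polynomial_function (\<lambda>p. gram (w p) $ k $ l)"
    "real_polynomial_function (\<lambda>p. gram_replace (w p) c m $ k $ l)" for k l m
    unfolding gram_def gram_replace_def
    by (cases "l = m"; simp add: real_polynomial_function_inner poly)+
  then have "polynomial_function r"
    unfolding r_def
    by (intro polynomial_function_diff polynomial_function_sum polynomial_function_mult poly
        polynomial_function_const)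
      (simp_all add: real_polynomial_function_det flip: real_polynomial_function_eq)
  then show "\<forall>f\<in>?F. real_polynomial_function f"
    by (auto intro: real_polynomial_function_inner)
  have "(\<exists>x. (\<Sum>k\<in>UNIV. x $ k *\<^sub>R w p k) = c) \<longleftrightarrow> (\<forall>f\<in>?F. f p = 0)" if "p \<in> S" for p
  proof -
    have "(\<exists>x. (\<Sum>k\<in>UNIV. x $ k *\<^sub>R w p k) = c) \<longleftrightarrow> r p = 0"
      using combination_iff_gram[of "w p" c, OF indep[OF that]] by (simp add: r_def)
    also have "\<dots> \<longleftrightarrow> (\<forall>f\<in>?F. f p = 0)"
      by (simp add: euclidean_all_zero_iff)
    finally show ?thesis .
  qed
  then show "{p \<in> S. \<exists>x. (\<Sum>k\<in>UNIV. x $ k *\<^sub>R w p k) = c} = {p \<in> S. \<forall>f\<in>?F. f p = 0}"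
    by (intro Collect_cong conj_cong refl)
qed

section \<open>The Lyapunov model as an algebraic set\<close>

text \<open>Indexed by (row, column), whereas an edge \<open>(i, j)\<close> corresponds to the entry
  in row \<open>j\<close>, column \<open>i\<close>.\<close>

definition matrix_unit :: "'n \<times> 'n \<Rightarrow> real ^ 'n::finite ^ 'n" where
  "matrix_unit k = axis (fst k) (axis (snd k) 1)"

lemma sum_matrix_unit: "(\<Sum>k\<in>UNIV. x $ k *\<^sub>R matrix_unit k) = (\<chi> i j. x $ (i, j))"
proof -
  have "(\<Sum>k\<in>UNIV. x $ k * matrix_unit k $ i $ j) = x $ (i, j)" for i j
  proof -
    have "x $ k * matrix_unit k $ i $ j = (if k = (i, j) then x $ k else 0)" for k
      by (cases k) (auto simp: matrix_unit_def axis_def)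
    then show ?thesis by simp
  qed
  then show ?thesis by (simp add: vec_eq_iff)
qed

text \<open>
  Recording the entries off \<open>E\<close> as a second component makes the Lyapunov map injective on all
  matrices, so that the Gram matrix may be indexed by all pairs instead of by \<open>E\<close>.
\<close>

definition off_edges :: "('n \<times> 'n) set \<Rightarrow> real ^ 'n ^ 'n \<Rightarrow> real ^ 'n::finite ^ 'n" where
  "off_edges E M = (\<chi> j i. if (i, j) \<in> E then 0 else M $ j $ i)"

lemma linear_off_edges: "linear (off_edges E)"
  by (rule linearI) (simp_all add: vec_eq_iff off_edges_def)

lemma off_edges_eq_0_iff: "off_edges E M = 0 \<longleftrightarrow> M \<in> edge_matrices E"
  by (auto simp: off_edges_def edge_matrices_def vec_eq_iff)

lemma algebraic_lyapunov_model:
  assumes E: "simple_digraph E"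
  shows "algebraic_subset_of_PD (lyapunov_model E C)"
proof -
  \<comment> \<open>The images of the matrix units under the augmented map; \<Sigma> lies in the
    model iff \<open>(- C, 0)\<close> is a combination of them.\<close>
  define w where
    "w \<Sigma> k = (lyapunov_map \<Sigma> (matrix_unit k), off_edges E (matrix_unit k))" for \<Sigma> k
  have sum_w: "(\<Sum>k\<in>UNIV. x $ k *\<^sub>R w \<Sigma> k) =
      (lyapunov_map \<Sigma> (\<chi> i j. x $ (i, j)), off_edges E (\<chi> i j. x $ (i, j)))" for \<Sigma> x
    unfolding w_def sum_matrix_unit[symmetric] linear_sum[OF linear_lyapunov_map]
      linear_sum[OF linear_off_edges] linear_scale[OF linear_lyapunov_map] linear_scale[OF linear_off_edges]
    by (simp add: prod_eq_iff fst_sum snd_sum)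
  have "polynomial_function (\<lambda>\<Sigma>. w \<Sigma> k)" for k
  proof -
    \<comment> \<open>Only the first component depends on \<Sigma>, and linearly; the second enters
      as a constant.\<close>
    have "linear (\<lambda>\<Sigma>. (lyapunov_map \<Sigma> (matrix_unit k), 0 :: real ^ 'a ^ 'a))"
      using linear_lyapunov_map_left[of "matrix_unit k"] by (auto simp: linear_iff)
    then have "polynomial_function (\<lambda>\<Sigma>. (lyapunov_map \<Sigma> (matrix_unit k), 0) + (0, off_edges E (matrix_unit k)))"
      by (intro polynomial_function_add polynomial_function_const polynomial_function_bounded_linear)
        (simp add: linear_conv_bounded_linear)
    then show ?thesis by (simp add: w_def)
  qed
  moreover have "x = 0" if "\<Sigma> \<in> PD" "(\<Sum>k\<in>UNIV. x $ k *\<^sub>R w \<Sigma> k) = 0" for \<Sigma> x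
  proof -
    \<comment> \<open>The second component puts the coefficient matrix into
      \<open>edge_matrices E\<close>, the first into the kernel of the Lyapunov map.\<close>
    have "(\<chi> i j. x $ (i, j)) = (0 :: real ^ 'a ^ 'a)"
    proof (rule lyapunov_map_injective[OF E _ that(1)])
      note zero = that(2)[unfolded sum_w zero_prod_def prod.inject]
      show "(\<chi> i j. x $ (i, j)) \<in> edge_matrices E"
        using zero by (simp only: off_edges_eq_0_iff)
      show "lyapunov_map \<Sigma> (\<chi> i j. x $ (i, j)) = 0"
        using zero by (simp only:)
    qed
    then have "x $ (i, j) = 0" for i j
      by (simp add: vec_eq_iff)
    then show ?thesis by (simp add: vec_eq_iff)
  qed
  ultimately obtain F where F: "\<forall>f\<in>F. real_polynomial_function f"
    "{\<Sigma> \<in> PD. \<exists>x. (\<Sum>k\<in>UNIV. x $ k *\<^sub>R w \<Sigma> k) = (- C, 0)} = {\<Sigma> \<in> PD. \<forall>f\<in>F. f \<Sigma> = 0}"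
    using combination_polynomial_conditions[of w PD "(- C, 0)"] by blast
  have "(\<exists>x. (\<Sum>k\<in>UNIV. x $ k *\<^sub>R w \<Sigma> k) = (- C, 0)) \<longleftrightarrow>
      (\<exists>M \<in> edge_matrices E. lyapunov_map \<Sigma> M = - C)" for \<Sigma>
  proof
    assume "\<exists>M \<in> edge_matrices E. lyapunov_map \<Sigma> M = - C"
    then obtain M where M: "M \<in> edge_matrices E" "lyapunov_map \<Sigma> M = - C" by blast
    let ?x = "\<chi> k. M $ fst k $ snd k"
    have "(\<chi> i j. ?x $ (i, j)) = M" by (simp add: vec_eq_iff)
    with M show "\<exists>x. (\<Sum>k\<in>UNIV. x $ k *\<^sub>R w \<Sigma> k) = (- C, 0)"
      by (intro exI[of _ ?x]) (simp only: sum_w prod.inject off_edges_eq_0_iff)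
  qed (auto simp: sum_w off_edges_eq_0_iff)
  then have "lyapunov_model E C = {\<Sigma> \<in> PD. \<forall>f\<in>F. f \<Sigma> = 0}"
    using F(2) by (simp add: lyapunov_model_def flip: lyapunov_map_def)
  with F(1) show ?thesis
    unfolding algebraic_subset_of_PD_def by blast
qed

text \<open>Polynomials are continuous, so their common zero set is closed in the whole matrix
  space, and \<open>S\<close> is its trace on \<open>PD\<close>.\<close>

lemma algebraic_imp_closedin:
  assumes "algebraic_subset_of_PD S"
  shows "closedin (top_of_set PD) S"
proof -
  obtain F where F: "\<forall>f\<in>F. real_polynomial_function f" "S = {\<Sigma> \<in> PD. \<forall>f\<in>F. f \<Sigma> = 0}"
    using assms unfolding algebraic_subset_of_PD_def by blast
  have "closed (f -` {0})" if "f \<in> F" for f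
    using that F(1) by (intro continuous_closed_vimage)
      (auto simp: real_polynomial_function_eq continuous_polymonial_function)
  then have "closed (\<Inter>f\<in>F. f -` {0})"
    by blast
  moreover have "S = PD \<inter> (\<Inter>f\<in>F. f -` {0})"
    using F(2) by auto
  ultimately show ?thesis
    by (simp add: closedin_closed_Int)
qed

theorem corollary33:
  fixes E :: "('n::finite \<times> 'n) set" and C :: "real ^ 'n ^ 'n"
  assumes "has_self_loops E" and "simple_digraph E" and "C \<in> PD"
  shows "algebraic_subset_of_PD (lyapunov_model E C)
    \<and> closedin (top_of_set PD) (lyapunov_model E C)
    \<and> (complete_digraph E \<longrightarrow> lyapunov_model E C = PD)"
  using assms algebraic_lyapunov_model algebraic_imp_closedin lyapunov_model_complete by blast

end
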